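(* A multigraph $G\in\mathcal{M}$ is uniquely determined by $|V(G)|$ and the family $(t_{\leq}(F,G))_{F\in\mathcal{M}}$. That is, if $G,G'\in\mathcal{M}$ satisfy $|V(G)|=|V(G')|$ and $t_{\leq}(F,G)=t_{\leq}(F,G')$ for every $F\in\mathcal{M}$, then $G=G'$ (i.e. $G$ and $G'$ are isomorphic as multigraphs).
   Context: $\mathbb{N}_0=\{0,1,2,\dots\}$, $[k]=\{1,\dots,k\}$. $\mathcal{M}$ is the set of isomorphism types of finite undirected multigraphs (multiple edges and loops allowed). If the vertices of $F$ are labeled by $[k]$, its adjacency matrix is $A=(A(i,j))_{i,j=1}^k$, $A(i,j)\in\mathbb{N}_0$, where for $i\ne j$, $A(i,j)=A(j,i)$ is the number of edges between $i$ and $j$, and $A(i,i)$ is twice the number of loops at $i$. If $F,G$ have adjacency matrices $A$ (size $k\times k$) and $B$ (size $n\times n$), the homomorphism density is $$t_{\leq}(F,G)=\frac{1}{n^k}\cdot\#\{\varphi:[k]\to[n] : A(i,j)\le B(\varphi(i),\varphi(j))\ \text{for all } i,j\in[k]\},$$ where $\varphi$ need not be injective; the value does not depend on the labelings. *)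

theory Defs
  imports Complex_Main "HOL-Library.FuncSet" "HOL-Library.Uprod"
begin

(* An edge is sent to the unordered pair of its end points; Upair u u is a loop at u.
   Distinct edges may have the same ends. *)
record ('v, 'e) multigraph =
  verts :: "'v set"
  edges :: "'e set"
  ends :: "'e \<Rightarrow> 'v uprod"

definition finite_multigraph :: "('v, 'e) multigraph \<Rightarrow> bool" where
  "finite_multigraph G \<longleftrightarrow>
     finite (verts G) \<and> finite (edges G) \<and> (\<forall>e\<in>edges G. set_uprod (ends G e) \<subseteq> verts G)"

(* The values of ends G outside edges G are irrelevant. *)
definition isomorphic :: "('v, 'e) multigraph \<Rightarrow> ('w, 'f) multigraph \<Rightarrow> bool" where
  "isomorphic G H \<longleftrightarrow>
     (\<exists>f g. bij_betw f (verts G) (verts H) \<and> bij_betw g (edges G) (edges H) \<and>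
        (\<forall>e\<in>edges G. ends H (g e) = map_uprod f (ends G e)))"

definition adj :: "('v, 'e) multigraph \<Rightarrow> 'v \<Rightarrow> 'v \<Rightarrow> nat" where
  "adj G u v =
     (if u = v then 2 * card {e \<in> edges G. ends G e = Upair u u}
      else card {e \<in> edges G. ends G e = Upair u v})"

(* The maps are indexed by the vertices themselves instead of by labels in [k] and [n];
   lemma t_le_labelled shows that every choice of labelings gives this value.
   The functions are extensional (PiE), so each map on the vertices is counted once. *)
definition t_le :: "('v, 'e) multigraph \<Rightarrow> ('w, 'f) multigraph \<Rightarrow> real" where
  "t_le F G =
     real (card {\<phi> \<in> verts F \<rightarrow>\<^sub>E verts G.
              \<forall>u\<in>verts F. \<forall>v\<in>verts F. adj F u v \<le> adj G (\<phi> u) (\<phi> v)})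
     / real (card (verts G)) ^ card (verts F)"

lemma card_homs_reindex:
  assumes l: "bij_betw l V' V" and m: "bij_betw m W' W"
  shows "card {\<phi> \<in> V' \<rightarrow>\<^sub>E W'. \<forall>i\<in>V'. \<forall>j\<in>V'. A (l i) (l j) \<le> (B (m (\<phi> i)) (m (\<phi> j)) :: nat)}
       = card {\<phi> \<in> V \<rightarrow>\<^sub>E W. \<forall>u\<in>V. \<forall>v\<in>V. A u v \<le> B (\<phi> u) (\<phi> v)}"
    (is "card ?S' = card ?S")
proof -
  let ?l = "inv_into V' l" and ?m = "inv_into W' m"
  have l1: "?l (l i) = i" if "i \<in> V'" for i using l that by (rule bij_betw_inv_into_left)
  have l2: "l (?l v) = v" if "v \<in> V" for v using l that by (rule bij_betw_inv_into_right)
  have l3: "l i \<in> V" if "i \<in> V'" for i using l that by (rule bij_betwE[rule_format])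
  have l4: "?l v \<in> V'" if "v \<in> V" for v
    using bij_betw_inv_into[OF l] that by (rule bij_betwE[rule_format])
  have m1: "?m (m i) = i" if "i \<in> W'" for i using m that by (rule bij_betw_inv_into_left)
  have m2: "m (?m v) = v" if "v \<in> W" for v using m that by (rule bij_betw_inv_into_right)
  have m3: "m i \<in> W" if "i \<in> W'" for i using m that by (rule bij_betwE[rule_format])
  have m4: "?m v \<in> W'" if "v \<in> W" for v
    using bij_betw_inv_into[OF m] that by (rule bij_betwE[rule_format])
  have "bij_betw (\<lambda>\<phi>. restrict (\<lambda>v. m (\<phi> (?l v))) V) ?S' ?S"
  proof (rule bij_betw_byWitness[where f' = "\<lambda>\<psi>. restrict (\<lambda>i. ?m (\<psi> (l i))) V'"])
    show "\<forall>\<phi>\<in>?S'. restrict (\<lambda>i. ?m (restrict (\<lambda>v. m (\<phi> (?l v))) V (l i))) V' = \<phi>"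
    proof
      fix \<phi> assume "\<phi> \<in> ?S'"
      then have p: "\<phi> \<in> V' \<rightarrow>\<^sub>E W'" by blast
      show "restrict (\<lambda>i. ?m (restrict (\<lambda>v. m (\<phi> (?l v))) V (l i))) V' = \<phi>"
        by (rule PiE_ext[OF _ p]) (use PiE_mem[OF p] in \<open>auto simp: l1 l3 m1 m3 m4\<close>)
    qed
    show "\<forall>\<psi>\<in>?S. restrict (\<lambda>v. m (restrict (\<lambda>i. ?m (\<psi> (l i))) V' (?l v))) V = \<psi>"
    proof
      fix \<psi> assume "\<psi> \<in> ?S"
      then have p: "\<psi> \<in> V \<rightarrow>\<^sub>E W" by blast
      show "restrict (\<lambda>v. m (restrict (\<lambda>i. ?m (\<psi> (l i))) V' (?l v))) V = \<psi>"
        by (rule PiE_ext[OF _ p]) (use PiE_mem[OF p] in \<open>auto simp: l2 l4 m2 m3 m4\<close>)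
    qed
    show "(\<lambda>\<phi>. restrict (\<lambda>v. m (\<phi> (?l v))) V) ` ?S' \<subseteq> ?S"
    proof (intro image_subsetI CollectI conjI ballI)
      fix \<phi> assume p: "\<phi> \<in> ?S'"
      then have "\<And>i. i \<in> V' \<Longrightarrow> \<phi> i \<in> W'" by blast
      then show "restrict (\<lambda>v. m (\<phi> (?l v))) V \<in> V \<rightarrow>\<^sub>E W"
        by (auto simp: l4 m3)
      fix u v assume uv: "u \<in> V" "v \<in> V"
      have "A (l (?l u)) (l (?l v)) \<le> B (m (\<phi> (?l u))) (m (\<phi> (?l v)))"
        using p uv l4 by blast
      then show "A u v \<le> B (restrict (\<lambda>v. m (\<phi> (?l v))) V u) (restrict (\<lambda>v. m (\<phi> (?l v))) V v)"
        using uv by (simp add: l2)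
    qed
    show "(\<lambda>\<psi>. restrict (\<lambda>i. ?m (\<psi> (l i))) V') ` ?S \<subseteq> ?S'"
    proof (intro image_subsetI CollectI conjI ballI)
      fix \<psi> assume p: "\<psi> \<in> ?S"
      then have q: "\<And>v. v \<in> V \<Longrightarrow> \<psi> v \<in> W" by blast
      then show "restrict (\<lambda>i. ?m (\<psi> (l i))) V' \<in> V' \<rightarrow>\<^sub>E W'"
        by (auto simp: l3 m4)
      fix i j assume "i \<in> V'" "j \<in> V'"
      then show "A (l i) (l j) \<le>
          B (m (restrict (\<lambda>i. ?m (\<psi> (l i))) V' i)) (m (restrict (\<lambda>i. ?m (\<psi> (l i))) V' j))"
        using p q by (simp add: l3 m2)
    qed
  qed
  then show ?thesis by (rule bij_betw_same_card)
qed

lemma t_le_labelled: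
  assumes l: "bij_betw l {1..k::nat} (verts F)" and m: "bij_betw m {1..n::nat} (verts G)"
  shows "t_le F G =
    1 / real n ^ k * real (card {\<phi> \<in> {1..k} \<rightarrow>\<^sub>E {1..n}.
       \<forall>i\<in>{1..k}. \<forall>j\<in>{1..k}. adj F (l i) (l j) \<le> adj G (m (\<phi> i)) (m (\<phi> j))})"
  using card_homs_reindex[OF l m, of "adj F" "adj G"] bij_betw_same_card[OF l] bij_betw_same_card[OF m]
  by (simp add: t_le_def)

lemma adj_isomorphic:
  assumes G: "finite_multigraph G"
    and f: "bij_betw f (verts G) (verts H)" and g: "bij_betw g (edges G) (edges H)"
    and gf: "\<forall>e\<in>edges G. ends H (g e) = map_uprod f (ends G e)"
    and uv: "u \<in> verts G" "v \<in> verts G"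
  shows "adj H (f u) (f v) = adj G u v"
proof -
  have inj: "inj_on f (verts G)" using f by (rule bij_betw_imp_inj_on)
  have eq: "map_uprod f (ends G e) = Upair (f u) (f v) \<longleftrightarrow> ends G e = Upair u v" if "e \<in> edges G" for e
  proof (cases "ends G e")
    case (Upair a b)
    then have "a \<in> verts G" "b \<in> verts G" using G that by (force simp: finite_multigraph_def)+
    then show ?thesis using Upair uv inj by (auto simp: inj_on_eq_iff)
  qed
  have "{e \<in> edges H. ends H e = Upair (f u) (f v)} = g ` {e \<in> edges G. ends G e = Upair u v}"
    unfolding bij_betw_imp_surj_on[OF g, symmetric] using gf eq by auto
  moreover have "inj_on g {e \<in> edges G. ends G e = Upair u v}"
    using bij_betw_imp_inj_on[OF g] by (rule inj_on_subset) blast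
  ultimately have "card {e \<in> edges H. ends H e = Upair (f u) (f v)}
      = card {e \<in> edges G. ends G e = Upair u v}"
    by (simp add: card_image)
  moreover have "f u = f v \<longleftrightarrow> u = v" using inj uv by (auto simp: inj_on_eq_iff)
  ultimately show ?thesis by (auto simp: adj_def)
qed

lemma t_le_isomorphic:
  assumes "finite_multigraph F" "finite_multigraph G" "isomorphic F F'" "isomorphic G G'"
  shows "t_le F G = t_le F' G'"
proof -
  obtain l g where l: "bij_betw l (verts F) (verts F')"
    and F: "bij_betw g (edges F) (edges F')" "\<forall>e\<in>edges F. ends F' (g e) = map_uprod l (ends F e)"
    using assms(3) unfolding isomorphic_def by blast
  obtain m h where m: "bij_betw m (verts G) (verts G')"
    and G: "bij_betw h (edges G) (edges G')" "\<forall>e\<in>edges G. ends G' (h e) = map_uprod m (ends G e)"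
    using assms(4) unfolding isomorphic_def by blast
  have "{\<phi> \<in> verts F \<rightarrow>\<^sub>E verts G. \<forall>u\<in>verts F. \<forall>v\<in>verts F. adj F u v \<le> adj G (\<phi> u) (\<phi> v)}
      = {\<phi> \<in> verts F \<rightarrow>\<^sub>E verts G. \<forall>u\<in>verts F. \<forall>v\<in>verts F.
           adj F' (l u) (l v) \<le> adj G' (m (\<phi> u)) (m (\<phi> v))}"
    using adj_isomorphic[OF assms(1) l F] adj_isomorphic[OF assms(2) m G]
    by (intro Collect_cong conj_cong ball_cong refl) (simp add: PiE_mem[of _ "verts F" "\<lambda>_. verts G"])
  with card_homs_reindex[OF l m, of "adj F'" "adj G'"] bij_betw_same_card[OF l] bij_betw_same_card[OF m]
  show ?thesis by (simp add: t_le_def)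
qed

(* Multigraphs whose vertices and edges are natural numbers represent every isomorphism type. *)
lemma nat_representative:
  assumes G: "finite_multigraph G"
  obtains F :: "(nat, nat) multigraph" where "finite_multigraph F" "isomorphic G F"
proof -
  obtain f where f: "bij_betw f (verts G) {0..<card (verts G)}"
    using G ex_bij_betw_finite_nat unfolding finite_multigraph_def by blast
  obtain g where g: "bij_betw g (edges G) {0..<card (edges G)}"
    using G ex_bij_betw_finite_nat unfolding finite_multigraph_def by blast
  define F where "F = \<lparr>verts = {0..<card (verts G)}, edges = {0..<card (edges G)},
    ends = (\<lambda>i. map_uprod f (ends G (inv_into (edges G) g i)))\<rparr>"
  have iso: "isomorphic G F"
    unfolding isomorphic_def F_def
    using f g by (auto intro!: exI[of _ f] exI[of _ g] simp: bij_betw_inv_into_left[OF g])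
  have "set_uprod (ends F i) \<subseteq> verts F" if "i \<in> edges F" for i
  proof -
    have "inv_into (edges G) g i \<in> edges G"
      using bij_betwE[OF bij_betw_inv_into[OF g]] that by (simp add: F_def)
    then have "set_uprod (ends G (inv_into (edges G) g i)) \<subseteq> verts G"
      using G by (simp add: finite_multigraph_def)
    then have "f ` set_uprod (ends G (inv_into (edges G) g i)) \<subseteq> {0..<card (verts G)}"
      using bij_betw_imp_surj_on[OF f] by blast
    then show ?thesis by (simp add: F_def uprod.set_map)
  qed
  then have "finite_multigraph F" by (simp add: finite_multigraph_def F_def)
  with iso show thesis by (rule that[rotated])
qed

end

theory Submission
  imports Defs "HOL-Library.Countable"
begin

text \<open>
  Call a map \<open>\<phi> : V \<rightarrow> W\<close> a homomorphism of matrices from \<open>A\<close> to \<open>B\<close> if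
  \<open>A u v \<le> B (\<phi> u) (\<phi> v)\<close> for all \<open>u\<close> and \<open>v\<close>. Since the number of vertices is known, the
  densities determine the number of homomorphisms from every symmetric matrix with even diagonal
  into the adjacency matrix of \<open>G\<close>.

  They also determine the numbers of injective homomorphisms. Indeed, classify the homomorphisms
  from \<open>A\<close> by their kernel, the partition of \<open>V\<close> into the fibres. Those with a given kernel
  correspond to the injective homomorphisms from the quotient of \<open>A\<close>, whose entries are the maxima
  of \<open>A\<close> over pairs of blocks; a diagonal entry is rounded up to the next even number, which is
  harmless because the diagonal of an adjacency matrix is even. The only kernel without
  identifications belongs to the injective homomorphisms from \<open>A\<close> itself, and all other
  quotients are smaller, so induction on the size of \<open>V\<close> applies (\<open>card_inj_homs_eq\<close>).

  The identity is an injective homomorphism from \<open>G\<close> to \<open>G\<close>, so there is one from \<open>G\<close> to \<open>G'\<close>, and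
  likewise one from \<open>G'\<close> to \<open>G\<close>. Both are bijections on vertices, and they can only increase
  the sum of all entries of the adjacency matrix. Hence the two sums agree, the first bijection
  preserves the adjacency matrix exactly, and matching parallel edges extends it to an isomorphism.
\<close>

section \<open>Homomorphisms of matrices and their kernels\<close>

text \<open>Order-preserving maps between square matrices indexed by \<open>V\<close> and \<open>W\<close>; as in the
  definition of the density, the maps are extensional, so that each is counted once.\<close>

definition homs :: "'a set \<Rightarrow> ('a \<Rightarrow> 'a \<Rightarrow> nat) \<Rightarrow> 'b set \<Rightarrow> ('b \<Rightarrow> 'b \<Rightarrow> nat) \<Rightarrow> ('a \<Rightarrow> 'b) set" where
  "homs V A W B = {\<phi> \<in> V \<rightarrow>\<^sub>E W. \<forall>u\<in>V. \<forall>v\<in>V. A u v \<le> B (\<phi> u) (\<phi> v)}"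

definition inj_homs :: "'a set \<Rightarrow> ('a \<Rightarrow> 'a \<Rightarrow> nat) \<Rightarrow> 'b set \<Rightarrow> ('b \<Rightarrow> 'b \<Rightarrow> nat) \<Rightarrow> ('a \<Rightarrow> 'b) set" where
  "inj_homs V A W B = {\<phi> \<in> homs V A W B. inj_on \<phi> V}"

text \<open>The matrices that occur as adjacency matrices of multigraphs with vertex set \<open>V\<close>.\<close>

definition adj_matrix :: "'a set \<Rightarrow> ('a \<Rightarrow> 'a \<Rightarrow> nat) \<Rightarrow> bool" where
  "adj_matrix V A \<longleftrightarrow> (\<forall>u\<in>V. even (A u u)) \<and> (\<forall>u\<in>V. \<forall>v\<in>V. A u v = A v u)"

text \<open>The kernel of a map, that is the partition of \<open>V\<close> into its fibres, is encoded by the map that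
  sends each element to the least element of its fibre.\<close>

definition kernel_map :: "nat set \<Rightarrow> (nat \<Rightarrow> 'b) \<Rightarrow> nat \<Rightarrow> nat" where
  "kernel_map V \<phi> = restrict (\<lambda>v. LEAST u. u \<in> V \<and> \<phi> u = \<phi> v) V"

lemma kernel_props:
  assumes "v \<in> V"
  shows "kernel_map V \<phi> v \<in> V" "\<phi> (kernel_map V \<phi> v) = \<phi> v"
  using LeastI[of "\<lambda>u. u \<in> V \<and> \<phi> u = \<phi> v" v] assms by (auto simp: kernel_map_def)

lemma kernel_eq_iff:
  assumes "u \<in> V" "v \<in> V"
  shows "kernel_map V \<phi> u = kernel_map V \<phi> v \<longleftrightarrow> \<phi> u = \<phi> v"
proof
  assume "kernel_map V \<phi> u = kernel_map V \<phi> v"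
  then show "\<phi> u = \<phi> v" using kernel_props(2)[of _ V \<phi>] assms by metis
next
  assume "\<phi> u = \<phi> v"
  then show "kernel_map V \<phi> u = kernel_map V \<phi> v" using assms by (simp add: kernel_map_def)
qed

lemma kernel_cong:
  assumes "\<And>u v. u \<in> V \<Longrightarrow> v \<in> V \<Longrightarrow> \<phi> u = \<phi> v \<longleftrightarrow> \<psi> u = \<psi> v"
  shows "kernel_map V \<phi> = kernel_map V \<psi>"
proof
  fix v
  have "(\<lambda>u. u \<in> V \<and> \<phi> u = \<phi> v) = (\<lambda>u. u \<in> V \<and> \<psi> u = \<psi> v)" if "v \<in> V"
    using assms that by auto
  then show "kernel_map V \<phi> v = kernel_map V \<psi> v" by (simp add: kernel_map_def)
qed

text \<open>The maps that encode some partition of \<open>V\<close> are the fixed points of \<^const>\<open>kernel_map\<close>.\<close>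

definition kernels :: "nat set \<Rightarrow> (nat \<Rightarrow> nat) set" where
  "kernels V = {r \<in> V \<rightarrow>\<^sub>E V. kernel_map V r = r}"

lemma kernel_in_kernels: "kernel_map V \<phi> \<in> kernels V"
proof -
  have "kernel_map V \<phi> \<in> V \<rightarrow>\<^sub>E V"
    using kernel_props(1)[of _ V \<phi>] by (auto simp: kernel_map_def)
  moreover have "kernel_map V (kernel_map V \<phi>) = kernel_map V \<phi>"
    by (rule kernel_cong) (simp add: kernel_eq_iff)
  ultimately show ?thesis by (simp add: kernels_def)
qed

lemma finite_kernels: "finite V \<Longrightarrow> finite (kernels V)"
  by (simp add: kernels_def finite_PiE)

lemma kernels_idem:
  assumes "r \<in> kernels V" "v \<in> V"
  shows "r v \<in> V" "r (r v) = r v"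
  using kernel_props[OF assms(2), of r] assms(1) by (auto simp: kernels_def)

lemma kernel_eq_kernels_iff:
  assumes "r \<in> kernels V"
  shows "kernel_map V \<phi> = r \<longleftrightarrow> (\<forall>u\<in>V. \<forall>v\<in>V. \<phi> u = \<phi> v \<longleftrightarrow> r u = r v)"
proof
  assume "kernel_map V \<phi> = r"
  then show "\<forall>u\<in>V. \<forall>v\<in>V. \<phi> u = \<phi> v \<longleftrightarrow> r u = r v" using kernel_eq_iff[of _ V _ \<phi>] by blast
next
  assume "\<forall>u\<in>V. \<forall>v\<in>V. \<phi> u = \<phi> v \<longleftrightarrow> r u = r v"
  then have "kernel_map V \<phi> = kernel_map V r" by (intro kernel_cong) blast
  then show "kernel_map V \<phi> = r" using assms by (simp add: kernels_def)
qed

section \<open>Quotient matrices\<close>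

text \<open>The largest entry of \<open>A\<close> between the blocks represented by \<open>i\<close> and \<open>j\<close>. It is meaningful only
  for \<open>i\<close> and \<open>j\<close> in \<open>r ` V\<close>, where the set under the maximum is not empty.\<close>

definition block_max :: "'a set \<Rightarrow> ('a \<Rightarrow> 'a) \<Rightarrow> ('a \<Rightarrow> 'a \<Rightarrow> nat) \<Rightarrow> 'a \<Rightarrow> 'a \<Rightarrow> nat" where
  "block_max V r A i j = Max ((\<lambda>(u, v). A u v) ` {(u, v) \<in> V \<times> V. r u = i \<and> r v = j})"

text \<open>The quotient of \<open>A\<close> by the partition encoded by \<open>r\<close>, indexed by the representatives; the
  diagonal is rounded up to even numbers.\<close>

definition quotient_matrix :: "'a set \<Rightarrow> ('a \<Rightarrow> 'a) \<Rightarrow> ('a \<Rightarrow> 'a \<Rightarrow> nat) \<Rightarrow> 'a \<Rightarrow> 'a \<Rightarrow> nat" where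
  "quotient_matrix V r A i j =
     (if i = j then 2 * ((block_max V r A i j + 1) div 2) else block_max V r A i j)"

lemma block_max_le_iff:
  assumes "finite V" "i \<in> r ` V" "j \<in> r ` V"
  shows "block_max V r A i j \<le> b \<longleftrightarrow> (\<forall>u\<in>V. \<forall>v\<in>V. r u = i \<longrightarrow> r v = j \<longrightarrow> A u v \<le> b)"
proof -
  have "finite {(u, v) \<in> V \<times> V. r u = i \<and> r v = j}"
    by (rule finite_subset[of _ "V \<times> V"]) (use assms(1) in auto)
  moreover have "{(u, v) \<in> V \<times> V. r u = i \<and> r v = j} \<noteq> {}" using assms by auto
  ultimately show ?thesis unfolding block_max_def by (subst Max_le_iff) auto
qed

lemma quotient_matrix_le_iff:
  assumes "finite V" "i \<in> r ` V" "j \<in> r ` V" and "i = j \<Longrightarrow> even b"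
  shows "quotient_matrix V r A i j \<le> b \<longleftrightarrow> (\<forall>u\<in>V. \<forall>v\<in>V. r u = i \<longrightarrow> r v = j \<longrightarrow> A u v \<le> b)"
proof -
  have "quotient_matrix V r A i j \<le> b \<longleftrightarrow> block_max V r A i j \<le> b"
    using assms(4) unfolding quotient_matrix_def by (cases "i = j") (simp, presburger, simp)
  then show ?thesis using block_max_le_iff[OF assms(1-3)] by simp
qed

lemma adj_matrix_quotient_matrix:
  assumes "adj_matrix V A"
  shows "adj_matrix (r ` V) (quotient_matrix V r A)"
proof -
  have "block_max V r A i j = block_max V r A j i" for i j
  proof -
    have "(\<lambda>(u, v). A u v) ` {(u, v) \<in> V \<times> V. r u = i \<and> r v = j}
        = (\<lambda>(u, v). A u v) ` {(u, v) \<in> V \<times> V. r u = j \<and> r v = i}" (is "?f ` ?S i j = _")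
    proof -
      have "?f ` ?S i j \<subseteq> ?f ` ?S j i" for i j
      proof
        fix x assume "x \<in> ?f ` ?S i j"
        then obtain u v where "u \<in> V" "v \<in> V" "r u = i" "r v = j" "x = A u v" by auto
        then show "x \<in> ?f ` ?S j i"
          using assms by (intro image_eqI[of _ _ "(v, u)"]) (auto simp: adj_matrix_def)
      qed
      then show ?thesis by blast
    qed
    then show ?thesis by (simp add: block_max_def)
  qed
  then show ?thesis by (simp add: adj_matrix_def quotient_matrix_def)
qed

text \<open>A map with kernel \<open>r\<close> is determined by its restriction to the representatives, which is
  injective. Two vertices of one block are sent to the same \<open>w\<close>, and there the rounding in the
  quotient does not matter because \<open>B w w\<close> is even.\<close>

lemma card_homs_kernel:
  assumes V: "finite V" and r: "r \<in> kernels V" and even: "\<And>w. w \<in> W \<Longrightarrow> even (B w w)"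
  shows "card {\<phi> \<in> homs V A W B. kernel_map V \<phi> = r} = card (inj_homs (r ` V) (quotient_matrix V r A) W B)"
    (is "card ?S = card ?T")
proof -
  note idem = kernels_idem[OF r]
  have q: "quotient_matrix V r A (r x) (r y) \<le> B a b \<longleftrightarrow>
      (\<forall>u\<in>V. \<forall>v\<in>V. r u = r x \<longrightarrow> r v = r y \<longrightarrow> A u v \<le> B a b)"
    if "x \<in> V" "y \<in> V" "a \<in> W" "r x = r y \<Longrightarrow> a = b" for x y a b
    by (rule quotient_matrix_le_iff) (use that V even in auto)
  have "bij_betw (\<lambda>\<phi>. restrict \<phi> (r ` V)) ?S ?T"
  proof (rule bij_betw_byWitness[where f' = "\<lambda>\<psi>. restrict (\<lambda>v. \<psi> (r v)) V"])
    show "\<forall>\<phi>\<in>?S. restrict (\<lambda>v. restrict \<phi> (r ` V) (r v)) V = \<phi>"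
    proof
      fix \<phi> assume p: "\<phi> \<in> ?S"
      then have "\<phi> (r v) = \<phi> v" if "v \<in> V" for v
        using kernel_props(2)[OF that, of \<phi>] by simp
      moreover have "\<phi> \<in> extensional V" using p by (auto simp: homs_def PiE_def)
      ultimately show "restrict (\<lambda>v. restrict \<phi> (r ` V) (r v)) V = \<phi>"
        by (intro extensionalityI[of _ V]) auto
    qed
    show "\<forall>\<psi>\<in>?T. restrict (restrict (\<lambda>v. \<psi> (r v)) V) (r ` V) = \<psi>"
    proof
      fix \<psi> assume "\<psi> \<in> ?T"
      then have "\<psi> \<in> extensional (r ` V)" by (auto simp: inj_homs_def homs_def PiE_def)
      then show "restrict (restrict (\<lambda>v. \<psi> (r v)) V) (r ` V) = \<psi>"
        by (intro extensionalityI[of _ "r ` V"]) (auto simp: idem)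
    qed
    show "(\<lambda>\<phi>. restrict \<phi> (r ` V)) ` ?S \<subseteq> ?T"
    proof (rule image_subsetI)
      fix \<phi> assume p: "\<phi> \<in> ?S"
      then have ker: "\<phi> u = \<phi> v \<longleftrightarrow> r u = r v" if "u \<in> V" "v \<in> V" for u v
        using kernel_eq_kernels_iff[OF r, of \<phi>] that by blast
      have W: "\<phi> v \<in> W" if "v \<in> V" for v using p that by (auto simp: homs_def)
      have le: "A u v \<le> B (\<phi> u) (\<phi> v)" if "u \<in> V" "v \<in> V" for u v
        using p that by (auto simp: homs_def)
      have rr: "\<phi> (r u) = \<phi> u" if "u \<in> V" for u using ker idem that by blast
      have "quotient_matrix V r A (r x) (r y) \<le> B (\<phi> (r x)) (\<phi> (r y))" if "x \<in> V" "y \<in> V" for x y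
      proof (subst q)
        show "\<forall>u\<in>V. \<forall>v\<in>V. r u = r x \<longrightarrow> r v = r y \<longrightarrow> A u v \<le> B (\<phi> (r x)) (\<phi> (r y))"
          using le rr by metis
      qed (use that idem W in auto)
      moreover have "inj_on \<phi> (r ` V)" using ker idem by (auto simp: inj_on_def)
      ultimately show "restrict \<phi> (r ` V) \<in> ?T"
        using W idem(1) by (auto simp: inj_homs_def homs_def)
    qed
    show "(\<lambda>\<psi>. restrict (\<lambda>v. \<psi> (r v)) V) ` ?T \<subseteq> ?S"
    proof (rule image_subsetI)
      fix \<psi> assume p: "\<psi> \<in> ?T"
      have W: "\<psi> (r v) \<in> W" if "v \<in> V" for v using p that by (auto simp: inj_homs_def homs_def)
      have "inj_on \<psi> (r ` V)" using p by (simp add: inj_homs_def)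
      then have "kernel_map V (restrict (\<lambda>v. \<psi> (r v)) V) = r"
        by (subst kernel_eq_kernels_iff[OF r]) (auto dest: inj_onD)
      moreover have "A u v \<le> B (\<psi> (r u)) (\<psi> (r v))" if "u \<in> V" "v \<in> V" for u v
      proof -
        have "quotient_matrix V r A (r u) (r v) \<le> B (\<psi> (r u)) (\<psi> (r v))"
          using p that by (auto simp: inj_homs_def homs_def)
        then show ?thesis using that W by (subst (asm) q) auto
      qed
      ultimately show "restrict (\<lambda>v. \<psi> (r v)) V \<in> ?S" using W by (auto simp: homs_def)
    qed
  qed
  then show ?thesis by (rule bij_betw_same_card)
qed

lemma finite_homs: "finite V \<Longrightarrow> finite W \<Longrightarrow> finite (homs V A W B)"
  by (simp add: homs_def finite_PiE)

lemma restrict_id_in_kernels: "restrict id V \<in> kernels V"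
proof -
  have "kernel_map V (restrict id V) = restrict id V"
    using kernel_props[of _ V "restrict id V"] by (intro extensionalityI[of _ V]) (auto simp: kernel_map_def)
  then show ?thesis by (auto simp: kernels_def)
qed

lemma card_kernels_image_less:
  assumes V: "finite V" and r: "r \<in> kernels V" "r \<noteq> restrict id V"
  shows "card (r ` V) < card V"
proof -
  have "\<exists>v\<in>V. r v \<noteq> v"
  proof (rule ccontr)
    assume "\<not> ?thesis"
    moreover have "r \<in> extensional V" using r(1) by (auto simp: kernels_def PiE_def)
    ultimately have "r = restrict id V" by (intro extensionalityI[of _ V]) auto
    with r(2) show False by blast
  qed
  then obtain v where v: "v \<in> V" "r v \<noteq> v" by blast
  then have "v \<notin> r ` V" using kernels_idem[OF r(1)] by auto
  then have "r ` V \<subset> V" using v kernels_idem(1)[OF r(1)] by auto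
  then show ?thesis using V by (rule psubset_card_mono[rotated])
qed

lemma card_homs_eq_sum:
  assumes V: "finite V" and W: "finite W" and even: "\<And>w. w \<in> W \<Longrightarrow> even (B w w)"
  shows "card (homs V A W B) = card (inj_homs V A W B) +
    (\<Sum>r \<in> kernels V - {restrict id V}. card (inj_homs (r ` V) (quotient_matrix V r A) W B))"
proof -
  let ?S = "\<lambda>r. {\<phi> \<in> homs V A W B. kernel_map V \<phi> = r}"
  have "homs V A W B = (\<Union>r\<in>kernels V. ?S r)" using kernel_in_kernels by auto
  then have "card (homs V A W B) = card (\<Union>r\<in>kernels V. ?S r)" by simp
  also have "\<dots> = (\<Sum>r\<in>kernels V. card (?S r))"
    by (rule card_UN_disjoint) (auto simp: finite_kernels V finite_homs W)
  also have "\<dots> = card (?S (restrict id V)) + (\<Sum>r\<in>kernels V - {restrict id V}. card (?S r))"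
    by (rule sum.remove) (auto simp: finite_kernels V restrict_id_in_kernels)
  also have "?S (restrict id V) = inj_homs V A W B"
    by (auto simp: inj_homs_def inj_on_def kernel_eq_kernels_iff[OF restrict_id_in_kernels])
  also have "(\<Sum>r\<in>kernels V - {restrict id V}. card (?S r)) =
      (\<Sum>r\<in>kernels V - {restrict id V}. card (inj_homs (r ` V) (quotient_matrix V r A) W B))"
    by (rule sum.cong) (auto simp: card_homs_kernel V even)
  finally show ?thesis .
qed

text \<open>The restricted identity is the kernel of the injective maps; every other kernel gives a
  smaller quotient by \<open>card_kernels_image_less\<close>.\<close>

lemma card_inj_homs_eq:
  fixes V :: "nat set"
  assumes W: "finite W" "\<And>w. w \<in> W \<Longrightarrow> even (B w w)"
    and W': "finite W'" "\<And>w. w \<in> W' \<Longrightarrow> even (B' w w)"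
    and eq: "\<And>(V :: nat set) A. finite V \<Longrightarrow> adj_matrix V A \<Longrightarrow>
        card (homs V A W B) = card (homs V A W' B')"
    and "finite V" "adj_matrix V A"
  shows "card (inj_homs V A W B) = card (inj_homs V A W' B')"
  using assms(6,7)
proof (induction "card V" arbitrary: V A rule: less_induct)
  case less
  have "(\<Sum>r \<in> kernels V - {restrict id V}. card (inj_homs (r ` V) (quotient_matrix V r A) W B)) =
      (\<Sum>r \<in> kernels V - {restrict id V}. card (inj_homs (r ` V) (quotient_matrix V r A) W' B'))"
    using less by (intro sum.cong less.hyps) (auto simp: card_kernels_image_less adj_matrix_quotient_matrix)
  then show ?case
    using eq[OF less.prems] card_homs_eq_sum[OF less.prems(1) W(1), of B A, OF W(2)]
      card_homs_eq_sum[OF less.prems(1) W'(1), of B' A, OF W'(2)] by simp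
qed

section \<open>Multigraphs and adjacency matrices\<close>

lemma uprod_swap: "Upair u v = Upair v u"
  by simp

lemma adj_matrix_adj: "adj_matrix V (adj G)"
  by (auto simp: adj_matrix_def adj_def intro!: arg_cong[where f = card])

lemma t_le_homs:
  "t_le F G = real (card (homs (verts F) (adj F) (verts G) (adj G))) /
     real (card (verts G)) ^ card (verts F)"
  by (simp add: t_le_def homs_def)

lemma ex_multigraph_adj:
  fixes V :: "nat set"
  assumes V: "finite V" and A: "adj_matrix V A"
  obtains F :: "(nat, nat) multigraph" where "finite_multigraph F" "verts F = V"
    "\<And>u v. u \<in> V \<Longrightarrow> v \<in> V \<Longrightarrow> adj F u v = A u v"
proof -
  \<comment> \<open>The edge \<open>(u, v, i)\<close> is the \<open>i\<close>-th of the parallel edges between \<open>u \<le> v\<close>; a diagonal entry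
    counts each loop twice.\<close>
  define m where "m u v = (if u = v then A u u div 2 else A u v)" for u v
  define E where "E = (SIGMA u:V. SIGMA v:{v \<in> V. u \<le> v}. {..<m u v})"
  define F :: "(nat, nat) multigraph" where "F = \<lparr>verts = V, edges = to_nat ` E,
     ends = (\<lambda>e. case from_nat e :: nat \<times> nat \<times> nat of (u, v, i) \<Rightarrow> Upair u v)\<rparr>"
  have "finite E" using V by (auto simp: E_def)
  then have fin: "finite_multigraph F" using V by (auto simp: finite_multigraph_def F_def E_def)
  have le: "card {e \<in> edges F. ends F e = Upair u v} = m u v"
    if "u \<in> V" "v \<in> V" "u \<le> v" for u v
  proof -
    have "{e \<in> edges F. ends F e = Upair u v} = (\<lambda>i. to_nat (u, v, i)) ` {..<m u v}"
      using that by (auto simp: F_def E_def)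
    moreover have "inj_on (\<lambda>i. to_nat (u, v, i)) {..<m u v}" by (auto simp: inj_on_def)
    ultimately show ?thesis by (simp add: card_image)
  qed
  have "adj F u v = A u v" if uv: "u \<in> V" "v \<in> V" for u v
  proof (cases "u \<le> v")
    case True
    then show ?thesis using le[OF uv] A uv by (auto simp: adj_def m_def adj_matrix_def)
  next
    case False
    then have "adj F u v = m v u" using le[OF uv(2,1)] by (simp add: adj_def uprod_swap[of u v])
    then show ?thesis using False A uv by (auto simp: m_def adj_matrix_def)
  qed
  moreover have "verts F = V" by (simp add: F_def)
  ultimately show thesis using fin that by blast
qed

lemma card_homs_adj_eq:
  fixes G :: "('v, 'e) multigraph" and G' :: "('w, 'f) multigraph" and V :: "nat set"
  assumes G: "finite_multigraph G" "finite_multigraph G'" "card (verts G) = card (verts G')"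
    and t: "\<And>F :: (nat, nat) multigraph. finite_multigraph F \<Longrightarrow> t_le F G = t_le F G'"
    and V: "finite V" "adj_matrix V A"
  shows "card (homs V A (verts G) (adj G)) = card (homs V A (verts G') (adj G'))"
proof (cases "verts G = {}")
  \<comment> \<open>Without vertices the denominator of the density vanishes, but then the counts are trivial.\<close>
  case True
  then have "verts G' = {}" using G by (auto simp: finite_multigraph_def)
  then show ?thesis using True by (cases "V = {}") (auto simp: homs_def)
next
  case False
  then have pos: "card (verts G) > 0" using G(1) by (simp add: finite_multigraph_def card_gt_0_iff)
  obtain F :: "(nat, nat) multigraph" where F: "finite_multigraph F" "verts F = V"
    "\<And>u v. u \<in> V \<Longrightarrow> v \<in> V \<Longrightarrow> adj F u v = A u v"
    using ex_multigraph_adj[OF V] by metis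
  have "homs V A (verts G) (adj G) = homs (verts F) (adj F) (verts G) (adj G)"
    using F by (auto simp: homs_def)
  moreover have "homs V A (verts G') (adj G') = homs (verts F) (adj F) (verts G') (adj G')"
    using F by (auto simp: homs_def)
  ultimately show ?thesis using t[OF F(1)] pos G(3) by (simp add: t_le_homs)
qed

lemma ex_bij_adj_le:
  fixes G :: "('v, 'e) multigraph" and G' :: "('w, 'f) multigraph"
  assumes G: "finite_multigraph G" "finite_multigraph G'" "card (verts G) = card (verts G')"
    and t: "\<And>F :: (nat, nat) multigraph. finite_multigraph F \<Longrightarrow> t_le F G = t_le F G'"
  obtains f where "bij_betw f (verts G) (verts G')"
    "\<And>u v. u \<in> verts G \<Longrightarrow> v \<in> verts G \<Longrightarrow> adj G u v \<le> adj G' (f u) (f v)"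
proof -
  have fin: "finite (verts G)" "finite (verts G')" using G by (auto simp: finite_multigraph_def)
  \<comment> \<open>The vertices of \<open>G\<close> are numbered, because the source matrices are indexed by natural numbers.\<close>
  obtain l where l: "bij_betw l (verts G) {0..<card (verts G)}"
    using ex_bij_betw_finite_nat[OF fin(1)] by blast
  define N where "N = {0..<card (verts G)}"
  define h where "h = inv_into (verts G) l"
  define A where "A i j = adj G (h i) (h j)" for i j
  have h: "bij_betw h N (verts G)" using l by (simp add: N_def h_def bij_betw_inv_into)
  have N: "finite N" "adj_matrix N A"
    using adj_matrix_adj[of "verts G" G] bij_betwE[OF h] by (auto simp: N_def A_def adj_matrix_def)
  have "card (inj_homs N A (verts G) (adj G)) = card (inj_homs N A (verts G') (adj G'))"
    by (rule card_inj_homs_eq)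
      (auto simp: fin N adj_def card_homs_adj_eq[OF assms])
  moreover have "restrict h N \<in> inj_homs N A (verts G) (adj G)"
    using bij_betwE[OF h] bij_betw_imp_inj_on[OF h]
    by (auto simp: inj_homs_def homs_def A_def inj_on_def)
  moreover have "finite (inj_homs N A (verts G) (adj G))"
    using finite_homs[OF N(1) fin(1)] by (simp add: inj_homs_def)
  ultimately have "inj_homs N A (verts G') (adj G') \<noteq> {}" by (auto simp: card_eq_0_iff)
  then obtain \<phi> where p: "\<phi> \<in> N \<rightarrow>\<^sub>E verts G'" "inj_on \<phi> N"
    and le: "\<And>i j. i \<in> N \<Longrightarrow> j \<in> N \<Longrightarrow> A i j \<le> adj G' (\<phi> i) (\<phi> j)"
    by (auto simp: inj_homs_def homs_def)
  have "\<phi> ` N = verts G'"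
    using p fin G(3) by (intro card_subset_eq) (auto simp: card_image N_def)
  then have "bij_betw \<phi> N (verts G')" using p by (simp add: bij_betw_def)
  then have "bij_betw (\<phi> \<circ> l) (verts G) (verts G')"
    using l by (auto simp: N_def intro: bij_betw_trans)
  moreover have "adj G u v \<le> adj G' ((\<phi> \<circ> l) u) ((\<phi> \<circ> l) v)"
    if "u \<in> verts G" "v \<in> verts G" for u v
  proof -
    have "l u \<in> N" "l v \<in> N" using bij_betwE[OF l] that by (auto simp: N_def)
    then show ?thesis
      using le[of "l u" "l v"] that by (simp add: A_def h_def bij_betw_inv_into_left[OF l])
  qed
  ultimately show thesis using that by blast
qed

section \<open>From vertex bijections to isomorphisms\<close>

lemma ex_bij_betw_fibres:
  assumes fin: "finite E" "finite E'"
    and card: "\<And>p. card {e \<in> E. k e = p} = card {e \<in> E'. k' e = p}"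
  obtains g where "bij_betw g E E'" "\<And>e. e \<in> E \<Longrightarrow> k' (g e) = k e"
proof -
  have "\<exists>g. bij_betw g {e \<in> E. k e = p} {e \<in> E'. k' e = p}" for p
    by (rule finite_same_card_bij) (auto simp: fin card)
  then obtain b where b: "\<And>p. bij_betw (b p) {e \<in> E. k e = p} {e \<in> E'. k' e = p}" by metis
  define g where "g e = b (k e) e" for e
  have g: "g e \<in> E'" "k' (g e) = k e" if "e \<in> E" for e
    using bij_betwE[OF b[of "k e"]] that by (auto simp: g_def)
  have "inj_on g E"
  proof (rule inj_onI)
    fix x y assume xy: "x \<in> E" "y \<in> E" "g x = g y"
    then have "k x = k y" using g(2) by metis
    then show "x = y"
      using bij_betw_imp_inj_on[OF b[of "k x"]] xy by (auto simp: g_def dest: inj_onD)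
  qed
  moreover have "e' \<in> g ` E" if "e' \<in> E'" for e'
  proof -
    have "e' \<in> b (k' e') ` {e \<in> E. k e = k' e'}"
      using bij_betw_imp_surj_on[OF b[of "k' e'"]] that by simp
    then obtain e where "e \<in> E" "k e = k' e'" "e' = b (k' e') e" by blast
    then show ?thesis by (intro image_eqI[of _ _ e]) (simp_all add: g_def)
  qed
  ultimately have "bij_betw g E E'" using g(1) by (auto simp: bij_betw_def)
  then show thesis using g(2) that by blast
qed

lemma isomorphic_if_adj_eq:
  assumes G: "finite_multigraph G" "finite_multigraph G'"
    and f: "bij_betw f (verts G) (verts G')"
    and adj: "\<And>u v. u \<in> verts G \<Longrightarrow> v \<in> verts G \<Longrightarrow> adj G' (f u) (f v) = adj G u v"
  shows "isomorphic G G'"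
proof -
  have inj: "inj_on f (verts G)" using f by (rule bij_betw_imp_inj_on)
  \<comment> \<open>Equal entries of the adjacency matrices give equally many edges over each pair of ends; a pair
    that is not contained in the vertex set of \<open>G'\<close> has none on either side.\<close>
  have card: "card {e \<in> edges G. map_uprod f (ends G e) = p} = card {e \<in> edges G'. ends G' e = p}"
    for p
  proof (cases "set_uprod p \<subseteq> verts G'")
    case True
    obtain x y where p: "p = Upair x y" by (cases p)
    then have "x \<in> f ` verts G" "y \<in> f ` verts G" using True bij_betw_imp_surj_on[OF f] by auto
    then obtain u v where uv: "u \<in> verts G" "v \<in> verts G" "p = Upair (f u) (f v)"
      using p by blast
    have "map_uprod f (ends G e) = p \<longleftrightarrow> ends G e = Upair u v" if "e \<in> edges G" for e
    proof (cases "ends G e")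
      case (Upair a b)
      then have "a \<in> verts G" "b \<in> verts G" using G that by (force simp: finite_multigraph_def)+
      then show ?thesis using Upair uv inj by (auto simp: inj_on_eq_iff)
    qed
    then have "{e \<in> edges G. map_uprod f (ends G e) = p} = {e \<in> edges G. ends G e = Upair u v}"
      by blast
    moreover have "f u = f v \<longleftrightarrow> u = v" using inj uv by (auto simp: inj_on_eq_iff)
    ultimately show ?thesis using adj[OF uv(1,2)] uv(3) by (auto simp: adj_def split: if_splits)
  next
    case False
    have "f ` set_uprod (ends G e) \<subseteq> verts G'" if "e \<in> edges G" for e
      using G(1) that bij_betw_imp_surj_on[OF f] by (auto simp: finite_multigraph_def)
    then have "{e \<in> edges G. map_uprod f (ends G e) = p} = {}"
      using False by (force simp: uprod.set_map)
    moreover have "{e \<in> edges G'. ends G' e = p} = {}"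
      using False G(2) by (auto simp: finite_multigraph_def)
    ultimately show ?thesis by (simp only: card.empty)
  qed
  obtain g where "bij_betw g (edges G) (edges G')"
    "\<And>e. e \<in> edges G \<Longrightarrow> ends G' (g e) = map_uprod f (ends G e)"
    using ex_bij_betw_fibres[of "edges G" "edges G'" "\<lambda>e. map_uprod f (ends G e)" "ends G'"] G card
    by (auto simp: finite_multigraph_def)
  then show ?thesis using f unfolding isomorphic_def by blast
qed

lemma sum_bij_betw_pairs:
  assumes "bij_betw f V W"
  shows "(\<Sum>u\<in>V. \<Sum>v\<in>V. B (f u) (f v)) = (\<Sum>x\<in>W. \<Sum>y\<in>W. B x y)"
  by (simp add: sum.reindex_bij_betw[OF assms, of "B _"]
      sum.reindex_bij_betw[OF assms, of "\<lambda>x. sum (B x) W"])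

theorem proposition1:
  fixes G :: "('v, 'e) multigraph" and G' :: "('w, 'f) multigraph"
  assumes "finite_multigraph G" and "finite_multigraph G'"
    and "card (verts G) = card (verts G')"
    and "\<And>F :: (nat, nat) multigraph. finite_multigraph F \<Longrightarrow> t_le F G = t_le F G'"
  shows "isomorphic G G'"
proof -
  obtain f where f: "bij_betw f (verts G) (verts G')"
    and fle: "\<And>u v. u \<in> verts G \<Longrightarrow> v \<in> verts G \<Longrightarrow> adj G u v \<le> adj G' (f u) (f v)"
    using ex_bij_adj_le[OF assms] by metis
  obtain g where g: "bij_betw g (verts G') (verts G)"
    and gle: "\<And>u v. u \<in> verts G' \<Longrightarrow> v \<in> verts G' \<Longrightarrow> adj G' u v \<le> adj G (g u) (g v)"
    using ex_bij_adj_le[OF assms(2,1) assms(3)[symmetric] assms(4)[symmetric]] by metis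
  have fin: "finite (verts G)" using assms(1) by (simp add: finite_multigraph_def)
  \<comment> \<open>The left-hand side is the sum of all entries for \<open>G'\<close>, which \<open>g\<close> bounds by the sum for \<open>G\<close>.\<close>
  have "(\<Sum>u\<in>verts G. \<Sum>v\<in>verts G. adj G' (f u) (f v)) \<le> (\<Sum>u\<in>verts G. \<Sum>v\<in>verts G. adj G u v)"
    unfolding sum_bij_betw_pairs[OF f] sum_bij_betw_pairs[OF g, of "adj G", symmetric]
    by (intro sum_mono gle)
  moreover have "(\<Sum>u\<in>verts G. \<Sum>v\<in>verts G. adj G u v)
      \<le> (\<Sum>u\<in>verts G. \<Sum>v\<in>verts G. adj G' (f u) (f v))"
    by (intro sum_mono fle)
  ultimately have sum: "(\<Sum>u\<in>verts G. \<Sum>v\<in>verts G. adj G u v)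
      = (\<Sum>u\<in>verts G. \<Sum>v\<in>verts G. adj G' (f u) (f v))" by (rule antisym[rotated])
  have "adj G u v = adj G' (f u) (f v)" if uv: "u \<in> verts G" "v \<in> verts G" for u v
  proof -
    have "(\<Sum>v\<in>verts G. adj G u v) = (\<Sum>v\<in>verts G. adj G' (f u) (f v))"
      by (rule sum_mono_inv[OF sum]) (auto intro: sum_mono fle simp: uv fin)
    then show ?thesis by (rule sum_mono_inv) (auto intro: fle simp: uv fin)
  qed
  then show ?thesis using isomorphic_if_adj_eq[OF assms(1,2) f] by simp
qed

end
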